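(* For every $l\ge3$, the transition matrix $P_{G_l}$ of the lazy two-particle exclusion process on the star graph $G_l$ has the following eigenvalues, with the stated multiplicities: - $1$, with multiplicity $1$; - $1-\frac{1}{2l}$, with multiplicity $l-1$; - $1-\frac1l$, with multiplicity $\binom{l}{2}-l$; - $\frac12$, with multiplicity $l-1$; - $\frac12-\frac1{2l}$, with multiplicity $1$.
   Context: The star graph $G_l$ is the tree with one center vertex $c$ of degree $l$ and $l$ leaves $1,\dots,l$. The lazy two-particle exclusion process on $G_l$ is a Markov chain on unordered pairs of distinct vertices of $G_l$. At each step, with probability $1/2$ nothing happens. Otherwise one of the $l$ edges is chosen uniformly; if exactly one endpoint of the chosen edge is occupied, that particle moves to the other endpoint, and otherwise nothing happens. The state space has $l+\binom{l}{2}$ states: the $l$ configurations $\{c,i\}$ and the $\binom{l}{2}$ configurations $\{i,j\}$ of two leaves. *)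

theory Defs
  imports "HOL-Probability.Probability_Mass_Function" "Jordan_Normal_Form.Char_Poly"
begin

text \<open>
  The star has vertex set \<open>{0..l}\<close>; the vertex \<open>0\<close> is the center and \<open>1, ..., l\<close> are the leaves.
\<close>

definition star_vertices :: "nat \<Rightarrow> nat set" where
  "star_vertices l = {0..l}"

definition star_edges :: "nat \<Rightarrow> nat set set" where
  "star_edges l = (\<lambda>i. {0, i}) ` {1..l}"

text \<open>A configuration of two indistinguishable particles is the set of occupied vertices.\<close>

definition two_particle_configs :: "'v set \<Rightarrow> 'v set set" where
  "two_particle_configs V = {s. s \<subseteq> V \<and> card s = 2}"

text \<open>
  If exactly one endpoint of \<open>e\<close> is occupied, then \<open>s - e\<close> forgets the particle sitting
  there and \<open>e - s\<close> is the vacant endpoint, to which it moves.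
\<close>

definition exclusion_move :: "'v set \<Rightarrow> 'v set \<Rightarrow> 'v set" where
  "exclusion_move e s = (if card (s \<inter> e) = 1 then (s - e) \<union> (e - s) else s)"

definition lazy_exclusion_step :: "'v set set \<Rightarrow> 'v set \<Rightarrow> 'v set pmf" where
  "lazy_exclusion_step E s =
     bind_pmf (bernoulli_pmf (1 / 2)) (\<lambda>lazy.
       if lazy then return_pmf s
       else map_pmf (\<lambda>e. exclusion_move e s) (pmf_of_set E))"

text \<open>
  The transition matrix of a Markov kernel \<open>K\<close> with respect to an enumeration \<open>ss\<close> of its
  states; entry \<open>(i, j)\<close> is the probability of moving from the \<open>i\<close>-th to the \<open>j\<close>-th state.
\<close>

definition transition_matrix :: "('s \<Rightarrow> 's pmf) \<Rightarrow> 's list \<Rightarrow> real mat" where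
  "transition_matrix K ss =
     Matrix.mat (length ss) (length ss) (\<lambda>(i, j). pmf (K (ss ! i)) (ss ! j))"

definition alg_multiplicity :: "'a :: idom mat \<Rightarrow> 'a \<Rightarrow> nat" where
  "alg_multiplicity A x = order x (char_poly A)"

end

(*
  With d = 1 - 1/l, the matrix P - d I has rank at most 2 l: it factors as U W, where the columns
  of U are the indicators of the configurations {c, i} and of the pairs of leaves containing i.
  By Sylvester's identity y^(2 l) det (y I - U W) = y^n det (y I - W U), so only the
  2 l by 2 l matrix W U matters. Its blocks are combinations of the identity and the all-ones
  matrix, and since they commute its characteristic polynomial reduces to that of a constant
  matrix, which Sylvester's identity again yields.
*)
theory Submission
  imports Defs
begin

section \<open>Determinant identities\<close>

lemma det_shifted_mult_commute:
  fixes A B :: "'a :: idom mat"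
  assumes A: "A \<in> carrier_mat n m" and B: "B \<in> carrier_mat m n"
  shows "x ^ m * det (x \<cdot>\<^sub>m 1\<^sub>m n - A * B) = x ^ n * det (x \<cdot>\<^sub>m 1\<^sub>m m - B * A)"
proof -
  \<comment> \<open>Both sides are evaluations of \<open>det M\<close>, up to the factor
    \<open>x ^ m\<close>. Multiplying on the left by \<open>L\<close> clears the lower left block
    and leaves \<open>x \<cdot>\<^sub>m 1\<^sub>m m - B * A\<close> in the corner; multiplying on
    the right by \<open>R\<close> clears the same block and leaves
    \<open>x \<cdot>\<^sub>m 1\<^sub>m n - A * B\<close>. Nothing is divided by \<open>x\<close>, so
    \<open>x = 0\<close> is allowed.\<close>
  define M where "M = four_block_mat (x \<cdot>\<^sub>m 1\<^sub>m n) A B (1\<^sub>m m)"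
  define L where "L = four_block_mat (1\<^sub>m n) (0\<^sub>m n m) (- B) (x \<cdot>\<^sub>m 1\<^sub>m m)"
  define R where "R = four_block_mat (1\<^sub>m n) (0\<^sub>m n m) (- B) (1\<^sub>m m)"
  have carrier: "M \<in> carrier_mat (n + m) (n + m)" "L \<in> carrier_mat (n + m) (n + m)"
      "R \<in> carrier_mat (n + m) (n + m)"
    unfolding M_def L_def R_def by auto
  have "L * M = four_block_mat (x \<cdot>\<^sub>m 1\<^sub>m n) A (0\<^sub>m m n) (x \<cdot>\<^sub>m 1\<^sub>m m - B * A)"
    unfolding L_def M_def using A B
    by (subst mult_four_block_mat[where ?nr1.0 = n and ?n1.0 = n and ?n2.0 = m and ?nr2.0 = m
          and ?nc1.0 = n and ?nc2.0 = m])
       (auto intro!: arg_cong2[where f = "four_block_mat _ _"] eq_matI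
          simp: mult_smult_assoc_mat mult_smult_distrib)
  then have "det L * det M = x ^ n * det (x \<cdot>\<^sub>m 1\<^sub>m m - B * A)"
    using A B carrier
    by (simp add: det_mult[symmetric])
       (subst det_four_block_mat_lower_left_zero[where n = n and m = m]; auto simp: det_smult)
  moreover have "det L = x ^ m"
    unfolding L_def using B
    by (subst det_four_block_mat_upper_right_zero[where n = n and m = m]) (auto simp: det_smult)
  moreover have "M * R = four_block_mat (x \<cdot>\<^sub>m 1\<^sub>m n - A * B) A (0\<^sub>m m n) (1\<^sub>m m)"
    unfolding R_def M_def using A B
    by (subst mult_four_block_mat[where ?nr1.0 = n and ?n1.0 = n and ?n2.0 = m and ?nr2.0 = m
          and ?nc1.0 = n and ?nc2.0 = m])
       (auto intro!: cong_four_block_mat eq_matI)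
  then have "det M * det R = det (x \<cdot>\<^sub>m 1\<^sub>m n - A * B)"
    using A B carrier
    by (simp add: det_mult[symmetric])
       (subst det_four_block_mat_lower_left_zero[where n = n and m = m]; auto)
  moreover have "det R = 1"
    unfolding R_def using B
    by (subst det_four_block_mat_upper_right_zero[where n = n and m = m]) auto
  ultimately show ?thesis by simp
qed

lemma poly_char_poly_eq_det:
  fixes A :: "'a :: field mat"
  assumes "A \<in> carrier_mat n n"
  shows "poly (char_poly A) x = det (x \<cdot>\<^sub>m 1\<^sub>m n - A)"
proof -
  have "- char_matrix A x = x \<cdot>\<^sub>m 1\<^sub>m n - A"
    using assms by (auto simp: char_matrix_def intro!: eq_matI)
  then show ?thesis using char_poly_matrix[OF assms] by simp
qed

text \<open>The constant matrix is a column times a row, so Sylvester's identity replaces it by the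
  1 by 1 matrix with entry \<open>v * real m\<close>.\<close>

lemma det_scalar_minus_const_mat:
  fixes u v :: real
  assumes "0 < m"
  shows "det (u \<cdot>\<^sub>m 1\<^sub>m m - Matrix.mat m m (\<lambda>_. v)) = u ^ (m - 1) * (u - v * real m)"
proof -
  define J where "J = Matrix.mat m m (\<lambda>_. v)"
  have J: "J \<in> carrier_mat m m" by (simp add: J_def)
  \<comment> \<open>Sylvester's identity carries an extra factor \<open>y\<close>, which cannot be
    cancelled at \<open>y = 0\<close>. The identity is therefore lifted to polynomials, where
    \<open>[:0, 1:]\<close> is nonzero and cancels, and only then evaluated at
    \<open>u\<close>.\<close>
  have "poly ([:0, 1:] * char_poly J) y
      = poly ([:0, 1:] * ([:0, 1:] ^ (m - 1) * [:- v * real m, 1:])) y" for y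
  proof -
    define A B where "A = Matrix.mat m 1 (\<lambda>_. v)" and "B = Matrix.mat 1 m (\<lambda>_. 1 :: real)"
    have AB: "A * B = J" and BA: "B * A = Matrix.mat 1 1 (\<lambda>_. v * real m)"
      by (auto simp: A_def B_def J_def scalar_prod_def intro!: eq_matI)
    have "y * poly (char_poly J) y = y ^ m * det (y \<cdot>\<^sub>m 1\<^sub>m 1 - B * A)"
      using det_shifted_mult_commute[of A m 1 B y] poly_char_poly_eq_det[OF J, of y]
      by (simp add: AB) (simp add: A_def B_def)
    also have "det (y \<cdot>\<^sub>m 1\<^sub>m 1 - B * A) = y - v * real m"
      by (subst det_single) (auto simp: BA)
    finally show ?thesis
      using assms by (cases m) (auto simp: algebra_simps)
  qed
  then have "[:0, 1:] * char_poly J = [:0, 1:] * ([:0, 1:] ^ (m - 1) * [:- v * real m, 1:])"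
    by (subst poly_eq_poly_eq_iff[symmetric]) blast
  then have "char_poly J = [:0, 1:] ^ (m - 1) * [:- v * real m, 1:]"
    by (subst (asm) mult_left_cancel) auto
  then have "poly (char_poly J) u = u ^ (m - 1) * (u - v * real m)"
    by (simp only: poly_mult poly_power) simp
  then show ?thesis
    using poly_char_poly_eq_det[OF J, of u] by (simp add: J_def)
qed

section \<open>Linear factors and finite sums\<close>

lemma poly_linear: "poly [:- a, 1:] x = x - (a :: 'a :: comm_ring_1)"
  by simp

lemma order_linear_power:
  fixes a x :: "'a :: idom"
  shows "order x ([:- a, 1:] ^ k) = (if x = a then k else 0)"
  by (auto simp: order_power_n_n intro!: order_0I)

lemma sum_nth_distinct:
  assumes "distinct xs"
  shows "(\<Sum>k = 0..<length xs. g (xs ! k)) = sum g (set xs)"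
  using sum.reindex_bij_betw[OF bij_betw_nth[OF assms refl refl], of g] by (simp add: atLeast0LessThan)

lemma sum_lessThan_add:
  fixes g :: "nat \<Rightarrow> 'a :: comm_monoid_add"
  shows "(\<Sum>j = 0..<m + n. g j) = (\<Sum>j = 0..<m. g j) + (\<Sum>j = 0..<n. g (m + j))"
  using sum.atLeastLessThan_concat[of 0 m "m + n" g] sum.shift_bounds_nat_ivl[of g 0 m n]
  by (simp add: add.commute)

section \<open>Configurations and moves on the star\<close>

lemma exclusion_move_center:
  assumes "i \<noteq> 0" "a \<noteq> (0 :: nat)"
  shows "exclusion_move {0, i} {0, a} = (if i = a then {0, a} else {a, i})"
  using assms by (auto simp: exclusion_move_def insert_commute Int_insert_left)

lemma exclusion_move_leaves:
  assumes "i \<noteq> 0" "a \<noteq> (0 :: nat)" "b \<noteq> 0" "a \<noteq> b"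
  shows "exclusion_move {0, i} {a, b} = (if i = a then {0, b} else if i = b then {0, a} else {a, b})"
  using assms by (auto simp: exclusion_move_def Int_insert_left Int_insert_right)

lemma finite_two_particle_configs: "finite V \<Longrightarrow> finite (two_particle_configs V)"
  by (simp add: two_particle_configs_def)

lemma center_config_in: "i \<in> {1..l} \<Longrightarrow> {0, i} \<in> two_particle_configs (star_vertices l)"
  by (auto simp: two_particle_configs_def star_vertices_def)

lemma leaf_config_in:
  "i \<in> {1..l} \<Longrightarrow> j \<in> {1..l} \<Longrightarrow> i \<noteq> j \<Longrightarrow> {i, j} \<in> two_particle_configs (star_vertices l)"
  by (auto simp: two_particle_configs_def star_vertices_def)

lemma star_config_containing_leaf:
  assumes "t \<in> two_particle_configs (star_vertices l)" "0 \<notin> t" "a \<in> t"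
  obtains q where "q \<in> {1..l}" "q \<noteq> a" "t = {a, q}"
proof -
  from assms(1) obtain x y where "t = {x, y}" "x \<noteq> y" "x \<le> l" "y \<le> l"
    by (auto simp: two_particle_configs_def star_vertices_def card_2_iff)
  with assms(2,3) that[of x] that[of y] show ?thesis
    by (auto simp: insert_commute)
qed

lemma star_config_cases:
  assumes "s \<in> two_particle_configs (star_vertices l)"
  obtains (center) a where "a \<in> {1..l}" "s = {0, a}"
    | (leaves) a b where "a \<in> {1..l}" "b \<in> {1..l}" "a \<noteq> b" "s = {a, b}"
proof -
  from assms obtain x y where s: "s = {x, y}" "x \<noteq> y" "x \<le> l" "y \<le> l"
    by (auto simp: two_particle_configs_def star_vertices_def card_2_iff)
  consider "x = 0" | "y = 0" | "x \<noteq> 0" "y \<noteq> 0" by blast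
  then show ?thesis
  proof cases
    case 1
    then show ?thesis using s center[of y] by simp
  next
    case 2
    then show ?thesis using s center[of x] by (simp add: insert_commute)
  next
    case 3
    then show ?thesis using s leaves[of x y] by simp
  qed
qed

text \<open>The edge at \<open>a\<close> has both endpoints occupied and changes nothing. Any other
  edge \<open>{0, i}\<close> sends the center particle to leaf \<open>i\<close>, so each pair of
  leaves containing \<open>a\<close> is reached through exactly one edge.\<close>

lemma card_moves_from_center:
  assumes a: "a \<in> {1..l}" and t: "t \<in> two_particle_configs (star_vertices l)"
  shows "card {i \<in> {1..l}. exclusion_move {0, i} {0, a} = t}
       = of_bool ({0, a} = t) + of_bool (0 \<notin> t \<and> a \<in> t)"
proof -
  have moves: "{i \<in> {1..l}. exclusion_move {0, i} {0, a} = t}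
      = {i \<in> {1..l}. (if i = a then {0, a} else {a, i}) = t}"
    using a by (intro Collect_cong conj_cong refl) (simp add: exclusion_move_center)
  consider "{0, a} = t" | "0 \<notin> t" "a \<in> t" | "{0, a} \<noteq> t" "\<not> (0 \<notin> t \<and> a \<in> t)" by blast
  then show ?thesis
  proof cases
    case 1
    then have "{i \<in> {1..l}. (if i = a then {0, a} else {a, i}) = t} = {a}"
      using a by (auto split: if_splits)
    then show ?thesis unfolding moves using 1 by auto
  next
    case 2
    then obtain q where "q \<in> {1..l}" "q \<noteq> a" "t = {a, q}"
      using star_config_containing_leaf[OF t] by blast
    then have "{i \<in> {1..l}. (if i = a then {0, a} else {a, i}) = t} = {q}"
      using a by (auto simp: doubleton_eq_iff split: if_splits)
    then show ?thesis unfolding moves using 2 by auto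
  next
    case 3
    then have none: "{i \<in> {1..l}. (if i = a then {0, a} else {a, i}) = t} = {}"
      using a by (auto split: if_splits)
    show ?thesis unfolding moves none using 3 by simp
  qed
qed

text \<open>The edges at \<open>a\<close> and \<open>b\<close> bring the respective particle to the
  center, leaving the other leaf occupied. The remaining \<open>l - 2\<close> edges have both
  endpoints vacant.\<close>

lemma card_moves_from_leaves:
  assumes a: "a \<in> {1..l}" and b: "b \<in> {1..l}" and ab: "a \<noteq> b"
  shows "card {i \<in> {1..l}. exclusion_move {0, i} {a, b} = t}
       = (l - 2) * of_bool ({a, b} = t) + of_bool (t = {0, a}) + of_bool (t = {0, b})"
proof -
  \<comment> \<open>The possible targets become opaque names known only to be distinct, which keeps
    equalities of doubletons out of the case analysis.\<close>
  define A B C where "A = {a, b}" and "B = {0, a}" and "C = {0, b}"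
  have distinct: "A \<noteq> B" "A \<noteq> C" "B \<noteq> C"
    using a b ab by (auto simp: A_def B_def C_def doubleton_eq_iff)
  have moves: "{i \<in> {1..l}. exclusion_move {0, i} {a, b} = t}
      = {i \<in> {1..l}. (if i = a then C else if i = b then B else A) = t}"
    using a b ab unfolding A_def B_def C_def
    by (intro Collect_cong conj_cong refl) (simp add: exclusion_move_leaves)
  have "card {i \<in> {1..l}. (if i = a then C else if i = b then B else A) = t}
      = (l - 2) * of_bool (A = t) + of_bool (t = B) + of_bool (t = C)"
  proof -
    consider "t = A" | "t = B" | "t = C" | "t \<noteq> A" "t \<noteq> B" "t \<noteq> C" by blast
    then show ?thesis
    proof cases
      case 1
      have "{i \<in> {1..l}. (if i = a then C else if i = b then B else A) = A} = {1..l} - {a, b}"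
        using distinct by auto
      moreover have "card ({1..l} - {a, b}) = l - 2"
        using a b ab by (subst card_Diff_subset) auto
      ultimately show ?thesis unfolding 1 using distinct by simp
    next
      case 2
      have "{i \<in> {1..l}. (if i = a then C else if i = b then B else A) = B} = {b}"
        using distinct a b ab by auto
      then show ?thesis unfolding 2 using distinct by simp
    next
      case 3
      have "{i \<in> {1..l}. (if i = a then C else if i = b then B else A) = C} = {a}"
        using distinct a b ab by auto
      then show ?thesis unfolding 3 using distinct by simp
    next
      case 4
      then have "{i \<in> {1..l}. (if i = a then C else if i = b then B else A) = t} = {}"
        by auto
      then show ?thesis using 4 by simp
    qed
  qed
  then show ?thesis
    unfolding moves by (simp add: A_def B_def C_def)
qed

section \<open>Transition probabilities\<close>

lemma pmf_lazy_exclusion_step: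
  assumes "finite E" "E \<noteq> {}"
  shows "pmf (lazy_exclusion_step E s) t
       = of_bool (s = t) / 2 + real (card {e \<in> E. exclusion_move e s = t}) / (2 * real (card E))"
proof -
  have "pmf (map_pmf (\<lambda>e. exclusion_move e s) (pmf_of_set E)) t
      = real (card {e \<in> E. exclusion_move e s = t}) / real (card E)"
    using assms
    by (simp add: pmf_map measure_pmf_of_set vimage_def Int_def)
  then show ?thesis
    by (simp add: lazy_exclusion_step_def pmf_bind pmf_return)
qed

text \<open>Edges correspond injectively to their leaves, so counting edges becomes counting
  leaves.\<close>

lemma pmf_lazy_exclusion_step_star:
  assumes "l \<ge> 1"
  shows "pmf (lazy_exclusion_step (star_edges l) s) t
       = of_bool (s = t) / 2 + real (card {i \<in> {1..l}. exclusion_move {0, i} s = t}) / (2 * real l)"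
proof -
  have inj: "inj_on (\<lambda>i. {0 :: nat, i}) A" for A
    by (auto simp: inj_on_def doubleton_eq_iff)
  have "{e \<in> star_edges l. exclusion_move e s = t}
      = (\<lambda>i. {0, i}) ` {i \<in> {1..l}. exclusion_move {0, i} s = t}"
    by (auto simp: star_edges_def)
  then have "card {e \<in> star_edges l. exclusion_move e s = t}
      = card {i \<in> {1..l}. exclusion_move {0, i} s = t}"
    by (simp add: card_image inj)
  moreover have "card (star_edges l) = l"
    by (simp add: star_edges_def card_image inj)
  moreover have "finite (star_edges l)" "star_edges l \<noteq> {}"
    using assms by (auto simp: star_edges_def)
  ultimately show ?thesis
    by (simp add: pmf_lazy_exclusion_step)
qed

section \<open>Low-rank decomposition of the transition matrix\<close>

definition center_ind :: "nat \<Rightarrow> nat set \<Rightarrow> real" where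
  "center_ind i s = of_bool (s = {0, i})"

definition leaf_ind :: "nat \<Rightarrow> nat set \<Rightarrow> real" where
  "leaf_ind i s = of_bool (0 \<notin> s \<and> i \<in> s)"

text \<open>This is P = d I + U W entry by entry. A pair of leaves stays put with probability 1/2 +
  (l-2)/(2l) = 1 - 1/l = d, so subtracting d empties its diagonal entry. A configuration
  \<open>{0, a}\<close> stays with probability 1/2 + 1/(2l), which exceeds d by 3/(2l) - 1/2
  (possibly negative). Each proper move has probability 1/(2l).\<close>

lemma pmf_lazy_exclusion_step_star_decomp:
  assumes s: "s \<in> two_particle_configs (star_vertices l)" and t: "t \<in> two_particle_configs (star_vertices l)"
  shows "pmf (lazy_exclusion_step (star_edges l) s) t
       = (1 - 1 / real l) * of_bool (s = t)
       + (\<Sum>i\<in>{1..l}. center_ind i s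
            * ((3 / (2 * real l) - 1 / 2) * center_ind i t + 1 / (2 * real l) * leaf_ind i t))
       + (\<Sum>i\<in>{1..l}. leaf_ind i s * (1 / (2 * real l) * center_ind i t))"
    (is "_ = _ + ?C + ?L")
  using s
proof (cases rule: star_config_cases)
  case (center a)
  have "?C = (\<Sum>i\<in>{1..l}. if a = i then
        (3 / (2 * real l) - 1 / 2) * center_ind i t + 1 / (2 * real l) * leaf_ind i t else 0)"
    using center by (intro sum.cong) (auto simp: center_ind_def doubleton_eq_iff)
  also have "\<dots> = (3 / (2 * real l) - 1 / 2) * center_ind a t + 1 / (2 * real l) * leaf_ind a t"
    using center by (simp add: sum.delta')
  finally have C: "?C = \<dots>" .
  have L: "?L = 0"
    using center by (simp add: leaf_ind_def)
  show ?thesis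
    unfolding C L using center card_moves_from_center[OF _ t, of a]
    by (auto simp: pmf_lazy_exclusion_step_star center_ind_def leaf_ind_def field_simps)
next
  case (leaves a b)
  have C: "?C = 0"
    using leaves by (intro sum.neutral) (auto simp: center_ind_def doubleton_eq_iff)
  have L: "?L = (\<Sum>i\<in>{a, b}. 1 / (2 * real l) * center_ind i t)"
    using leaves by (intro sum.mono_neutral_cong_right) (auto simp: leaf_ind_def)
  \<comment> \<open>Two distinct leaves exist, so the truncated difference \<open>l - 2\<close> in
    the edge count agrees with the real one.\<close>
  have "l \<ge> 2"
    using leaves by auto
  then show ?thesis
    unfolding C L using leaves card_moves_from_leaves[of a l b t]
    by (simp add: pmf_lazy_exclusion_step_star center_ind_def of_nat_diff field_simps)
qed

section \<open>Inner products of the indicators, and the determinant they lead to\<close>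

lemma sum_center_center:
  assumes "i \<in> {1..l}"
  shows "(\<Sum>s\<in>two_particle_configs (star_vertices l). center_ind i s * center_ind j s) = of_bool (i = j)"
proof -
  have "(\<Sum>s\<in>two_particle_configs (star_vertices l). center_ind i s * center_ind j s)
      = (\<Sum>s\<in>two_particle_configs (star_vertices l). if s = {0, i} then of_bool (i = j) else 0)"
    by (intro sum.cong) (auto simp: center_ind_def doubleton_eq_iff)
  then show ?thesis
    using center_config_in[OF assms] finite_two_particle_configs[of "star_vertices l"]
    by (simp add: sum.delta star_vertices_def)
qed

text \<open>The supports are disjoint because only one of them consists of configurations containing
  the center. This makes the lower right block of \<open>W * U\<close> vanish.\<close>

lemma center_times_leaf: "center_ind i s * leaf_ind j s = 0"
  by (auto simp: center_ind_def leaf_ind_def)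

lemma leaf_times_center: "leaf_ind j s * center_ind i s = 0"
  by (auto simp: center_ind_def leaf_ind_def)

text \<open>The sum counts the pairs of leaves containing both \<open>i\<close> and
  \<open>j\<close>: there are l - 1 of them if \<open>i = j\<close>, and only \<open>{i, j}\<close>
  otherwise. The value is split as a multiple of the identity plus the all-ones matrix.\<close>

lemma sum_leaf_leaf:
  assumes i: "i \<in> {1..l}" and j: "j \<in> {1..l}"
  shows "(\<Sum>s\<in>two_particle_configs (star_vertices l). leaf_ind i s * leaf_ind j s)
       = (real l - 2) * of_bool (i = j) + 1"
proof -
  let ?S = "two_particle_configs (star_vertices l)"
  have "(\<Sum>s\<in>?S. leaf_ind i s * leaf_ind j s) = (\<Sum>s\<in>?S. of_bool (0 \<notin> s \<and> i \<in> s \<and> j \<in> s))"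
    by (intro sum.cong) (auto simp: leaf_ind_def)
  also have "\<dots> = real (card {s \<in> ?S. 0 \<notin> s \<and> i \<in> s \<and> j \<in> s})"
    using finite_two_particle_configs[of "star_vertices l"]
    by (subst sum_of_bool_eq) (auto simp: star_vertices_def Int_def)
  also have "\<dots> = (real l - 2) * of_bool (i = j) + 1"
  proof (cases "i = j")
    case True
    have "{s \<in> ?S. 0 \<notin> s \<and> i \<in> s \<and> j \<in> s} = (\<lambda>q. {i, q}) ` ({1..l} - {i})"
      using True i leaf_config_in by (auto elim!: star_config_containing_leaf[of _ l i])
    moreover have "inj_on (\<lambda>q. {i, q}) A" for A
      by (auto simp: inj_on_def doubleton_eq_iff)
    ultimately show ?thesis
      using True i by (simp add: card_image of_nat_diff)
  next
    case False
    have "{s \<in> ?S. 0 \<notin> s \<and> i \<in> s \<and> j \<in> s} = {{i, j}}"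
      using False i j leaf_config_in[OF i j] by (auto elim!: star_config_containing_leaf[of _ l i])
    then show ?thesis using False by simp
  qed
  finally show ?thesis .
qed

text \<open>The matrix is \<open>W * U\<close>. After subtraction from \<open>y\<close> times the
  identity, the lower blocks are scalar and hence commute, so the determinant is that of an l by l
  combination of the blocks. There \<open>u\<close> collects the coefficient of the identity, and
  what remains is the constant matrix with entry \<open>\<beta>\<^sup>2\<close>.\<close>

lemma det_star_gram:
  fixes \<alpha> \<beta> y :: real
  assumes "0 < l"
  defines "u \<equiv> y\<^sup>2 - \<alpha> * y - \<beta>\<^sup>2 * (real l - 2)"
  shows "det (y \<cdot>\<^sub>m 1\<^sub>m (l + l) - four_block_mat (\<alpha> \<cdot>\<^sub>m 1\<^sub>m l)
           (Matrix.mat l l (\<lambda>(i, j). \<beta> * ((real l - 2) * of_bool (i = j) + 1)))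
           (\<beta> \<cdot>\<^sub>m 1\<^sub>m l) (0\<^sub>m l l))
       = u ^ (l - 1) * (u - \<beta>\<^sup>2 * real l)"
proof -
  define B where "B = Matrix.mat l l (\<lambda>(i, j). - \<beta> * ((real l - 2) * of_bool (i = j) + 1))"
  have B: "B \<in> carrier_mat l l"
    by (simp add: B_def)
  have "y \<cdot>\<^sub>m 1\<^sub>m (l + l) - four_block_mat (\<alpha> \<cdot>\<^sub>m 1\<^sub>m l)
           (Matrix.mat l l (\<lambda>(i, j). \<beta> * ((real l - 2) * of_bool (i = j) + 1)))
           (\<beta> \<cdot>\<^sub>m 1\<^sub>m l) (0\<^sub>m l l)
      = four_block_mat ((y - \<alpha>) \<cdot>\<^sub>m 1\<^sub>m l) B (- \<beta> \<cdot>\<^sub>m 1\<^sub>m l) (y \<cdot>\<^sub>m 1\<^sub>m l)"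
    by (intro eq_matI) (auto simp: B_def algebra_simps)
  also have "det \<dots> = det ((y - \<alpha>) \<cdot>\<^sub>m 1\<^sub>m l * (y \<cdot>\<^sub>m 1\<^sub>m l) - B * (- \<beta> \<cdot>\<^sub>m 1\<^sub>m l))"
    using B by (intro det_four_block_mat[of _ l]) (auto simp: mult_smult_distrib mult_smult_assoc_mat)
  also have "(y - \<alpha>) \<cdot>\<^sub>m 1\<^sub>m l * (y \<cdot>\<^sub>m 1\<^sub>m l) - B * (- \<beta> \<cdot>\<^sub>m 1\<^sub>m l)
      = u \<cdot>\<^sub>m 1\<^sub>m l - Matrix.mat l l (\<lambda>_. \<beta>\<^sup>2)"
    using B by (subst mult_smult_distrib[of _ l l _ l], simp, simp)+
      (auto intro!: eq_matI simp: B_def u_def power2_eq_square algebra_simps)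
  also have "det \<dots> = u ^ (l - 1) * (u - \<beta>\<^sup>2 * real l)"
    using assms(1) by (rule det_scalar_minus_const_mat)
  finally show ?thesis .
qed

section \<open>The characteristic polynomial\<close>

lemma length_star_configs:
  assumes "distinct ss" "set ss = two_particle_configs (star_vertices l)"
  shows "length ss = l + (l choose 2)"
proof -
  have "length ss = card (two_particle_configs (star_vertices l))"
    using assms distinct_card by metis
  also have "\<dots> = (Suc l choose 2)"
    unfolding two_particle_configs_def by (subst n_subsets) (auto simp: star_vertices_def)
  finally show ?thesis
    by (simp add: numeral_2_eq_2)
qed

text \<open>Sylvester's identity for \<open>U * W\<close> in the shifted variable \<open>y\<close>.
  The powers of \<open>y\<close> stay on both sides because \<open>y\<close> may be zero
  here.\<close>

lemma char_poly_star_exclusion_aux: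
  fixes l :: nat and ss :: "nat set list" and x :: real
  assumes "l \<ge> 1" and "distinct ss" and set_ss: "set ss = two_particle_configs (star_vertices l)"
  defines "P \<equiv> transition_matrix (lazy_exclusion_step (star_edges l)) ss"
    and "y \<equiv> x - (1 - 1 / real l)"
  shows "y ^ (l + l) * poly (char_poly P) x
       = y ^ length ss * ((x - (1 - 1 / (2 * real l))) * (x - 1 / 2)) ^ (l - 1)
           * ((x - 1) * (x - (1 / 2 - 1 / (2 * real l))))"
proof -
  define \<alpha> \<beta> where "\<alpha> = 3 / (2 * real l) - 1 / 2" and "\<beta> = 1 / (2 * real l)"
  define n where "n = length ss"
  define u where "u = y\<^sup>2 - \<alpha> * y - \<beta>\<^sup>2 * (real l - 2)"
  \<comment> \<open>Indices start at 0 and leaves at 1, hence the \<open>Suc\<close>. The first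
    \<open>l\<close> indices belong to the configurations \<open>{0, i}\<close>, the last
    \<open>l\<close> to the pairs of leaves through a given leaf.\<close>
  define U where "U = Matrix.mat n (l + l) (\<lambda>(k, j).
      if j < l then center_ind (Suc j) (ss ! k) else leaf_ind (Suc (j - l)) (ss ! k))"
  define W where "W = Matrix.mat (l + l) n (\<lambda>(j, k).
      if j < l then \<alpha> * center_ind (Suc j) (ss ! k) + \<beta> * leaf_ind (Suc j) (ss ! k)
      else \<beta> * center_ind (Suc (j - l)) (ss ! k))"
  have UW: "U \<in> carrier_mat n (l + l)" "W \<in> carrier_mat (l + l) n"
    by (simp_all add: U_def W_def)
  have P: "P \<in> carrier_mat n n"
    by (simp add: P_def transition_matrix_def n_def)
  have in_set: "ss ! k \<in> two_particle_configs (star_vertices l)" if "k < n" for k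
    using that set_ss nth_mem[of k ss] by (simp add: n_def)
  have sum_Suc: "(\<Sum>j = 0..<l. g (Suc j)) = (\<Sum>i\<in>{1..l}. g i)" for g :: "nat \<Rightarrow> real"
    using sum.shift_bounds_Suc_ivl[of g 0 l] by (simp add: atLeastLessThanSuc_atLeastAtMost)
  have "(U * W) $$ (k, m) = P $$ (k, m) - (1 - 1 / real l) * of_bool (k = m)"
    if km: "k < n" "m < n" for k m
  proof -
    have "(U * W) $$ (k, m) = (\<Sum>j = 0..<l + l. U $$ (k, j) * W $$ (j, m))"
      using UW km by (simp add: scalar_prod_def)
    also have "\<dots> = (\<Sum>j = 0..<l. center_ind (Suc j) (ss ! k)
            * (\<alpha> * center_ind (Suc j) (ss ! m) + \<beta> * leaf_ind (Suc j) (ss ! m)))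
        + (\<Sum>j = 0..<l. leaf_ind (Suc j) (ss ! k) * (\<beta> * center_ind (Suc j) (ss ! m)))"
      using km by (simp add: sum_lessThan_add U_def W_def)
    also have "\<dots> = P $$ (k, m) - (1 - 1 / real l) * of_bool (ss ! k = ss ! m)"
      using km pmf_lazy_exclusion_step_star_decomp[OF in_set[of k] in_set[of m]]
        sum_Suc[of "\<lambda>i. center_ind i (ss ! k)
            * (\<alpha> * center_ind i (ss ! m) + \<beta> * leaf_ind i (ss ! m))"]
        sum_Suc[of "\<lambda>i. leaf_ind i (ss ! k) * (\<beta> * center_ind i (ss ! m))"]
      by (simp add: P_def transition_matrix_def n_def \<alpha>_def \<beta>_def)
    \<comment> \<open>Distinctness of \<open>ss\<close> turns equality of states into equality of
      indices.\<close>
    finally show ?thesis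
      using km assms(2) by (simp add: nth_eq_iff_index_eq n_def)
  qed
  then have P_decomp: "x \<cdot>\<^sub>m 1\<^sub>m n - P = y \<cdot>\<^sub>m 1\<^sub>m n - U * W"
    using P UW by (intro eq_matI) (auto simp: y_def)
  have sum_nth: "(\<Sum>k = 0..<n. g (ss ! k)) = sum g (two_particle_configs (star_vertices l))"
    for g :: "nat set \<Rightarrow> real"
    using sum_nth_distinct[OF assms(2), of g] set_ss by (simp add: n_def)
  have WU: "W * U = four_block_mat (\<alpha> \<cdot>\<^sub>m 1\<^sub>m l)
      (Matrix.mat l l (\<lambda>(i, j). \<beta> * ((real l - 2) * of_bool (i = j) + 1)))
      (\<beta> \<cdot>\<^sub>m 1\<^sub>m l) (0\<^sub>m l l)" (is "_ = ?G")
  proof (rule eq_matI)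
    fix i j assume "i < dim_row ?G" "j < dim_col ?G"
    then have ij: "i < l + l" "j < l + l" by auto
    have "(W * U) $$ (i, j) = (\<Sum>k = 0..<n. W $$ (i, k) * U $$ (k, j))"
      using UW ij by (simp add: scalar_prod_def)
    \<comment> \<open>The summand is abstracted to a function of the state, so that
      \<open>sum_nth\<close> turns the sum over indices into one over configurations.\<close>
    also have "\<dots> = (\<Sum>k = 0..<n. (\<lambda>s.
          (if i < l then \<alpha> * center_ind (Suc i) s + \<beta> * leaf_ind (Suc i) s
             else \<beta> * center_ind (Suc (i - l)) s)
          * (if j < l then center_ind (Suc j) s else leaf_ind (Suc (j - l)) s)) (ss ! k))"
      using ij by (intro sum.cong) (auto simp: U_def W_def)
    also have "\<dots> = (\<Sum>s\<in>two_particle_configs (star_vertices l).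
          (if i < l then \<alpha> * center_ind (Suc i) s + \<beta> * leaf_ind (Suc i) s
             else \<beta> * center_ind (Suc (i - l)) s)
          * (if j < l then center_ind (Suc j) s else leaf_ind (Suc (j - l)) s))"
      by (rule sum_nth)
    also have "\<dots> = ?G $$ (i, j)"
      using ij
      by (cases "i < l"; cases "j < l")
         (auto simp: distrib_right mult.assoc center_times_leaf leaf_times_center sum_center_center
            sum_leaf_leaf sum_distrib_left[symmetric])
    finally show "(W * U) $$ (i, j) = ?G $$ (i, j)" .
  qed (use UW in auto)
  have "y ^ (l + l) * poly (char_poly P) x = y ^ n * det (y \<cdot>\<^sub>m 1\<^sub>m (l + l) - W * U)"
    unfolding poly_char_poly_eq_det[OF P] P_decomp by (rule det_shifted_mult_commute[OF UW])
  also have "det (y \<cdot>\<^sub>m 1\<^sub>m (l + l) - W * U) = u ^ (l - 1) * (u - \<beta>\<^sup>2 * real l)"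
    unfolding WU u_def using assms(1) by (intro det_star_gram) simp
  \<comment> \<open>As a quadratic in \<open>y\<close>, \<open>u\<close> has the roots 1/(2l) and
    1/l - 1/2; after subtracting \<open>\<beta>\<^sup>2 * real l\<close> the roots are 1/l and
    1/(2l) - 1/2. Adding 1 - 1/l returns to \<open>x\<close>.\<close>
  also have "u = (x - (1 - 1 / (2 * real l))) * (x - 1 / 2)"
    using assms(1) by (simp add: u_def y_def \<alpha>_def \<beta>_def power2_eq_square field_simps)
  also have "\<dots> - \<beta>\<^sup>2 * real l = (x - 1) * (x - (1 / 2 - 1 / (2 * real l)))"
    using assms(1) by (simp add: \<beta>_def power2_eq_square field_simps)
  finally show ?thesis
    by (simp add: n_def)
qed

text \<open>The pointwise identity is read as one between polynomials, where the power of the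
  nonzero factor for 1 - 1/l cancels. The exponents \<open>1\<close> give every factor the shape
  required by \<open>order_linear_power\<close>.\<close>

lemma char_poly_star_exclusion:
  fixes l :: nat and ss :: "nat set list"
  assumes l: "l \<ge> 3" and ss: "distinct ss" "set ss = two_particle_configs (star_vertices l)"
  shows "char_poly (transition_matrix (lazy_exclusion_step (star_edges l)) ss)
       = [:- (1 - 1 / real l), 1:] ^ ((l choose 2) - l)
         * [:- (1 - 1 / (2 * real l)), 1:] ^ (l - 1) * [:- (1 / 2), 1:] ^ (l - 1)
         * [:- 1, 1:] ^ 1 * [:- (1 / 2 - 1 / (2 * real l)), 1:] ^ 1"
    (is "?\<chi> = ?q")
proof -
  \<comment> \<open>Here \<open>l \<ge> 3\<close> enters: it makes \<open>(l choose 2) - l\<close>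
    an honest difference, so there are at least 2 l states.\<close>
  have "2 * l \<le> l * (l - 1)"
    using l by (simp add: mult.commute)
  then have "l \<le> l choose 2"
    unfolding choose_two by linarith
  then have len: "length ss = (l + l) + ((l choose 2) - l)"
    using length_star_configs[OF ss] by simp
  let ?D = "[:- (1 - 1 / real l), 1:] ^ (l + l)"
  have "poly (?D * ?\<chi>) x = poly (?D * ?q) x" for x
    using char_poly_star_exclusion_aux[OF _ ss, of x] l
    by (simp only: poly_mult poly_power poly_linear len power_add power_mult_distrib power_one_right
        mult_ac)
  then have "?D * ?\<chi> = ?D * ?q"
    by (subst poly_eq_poly_eq_iff[symmetric]) blast
  then show ?thesis
    by (subst (asm) mult_left_cancel) auto
qed

theorem mainTheorem9:
  fixes l :: nat and ss :: "nat set list" and P :: "real mat"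
  assumes "l \<ge> 3"
    and "distinct ss" and "set ss = two_particle_configs (star_vertices l)"
  defines "P \<equiv> transition_matrix (lazy_exclusion_step (star_edges l)) ss"
  shows "alg_multiplicity P 1 = 1 \<and>
         alg_multiplicity P (1 - 1 / (2 * real l)) = l - 1 \<and>
         alg_multiplicity P (1 - 1 / real l) = (l choose 2) - l \<and>
         alg_multiplicity P (1 / 2) = l - 1 \<and>
         alg_multiplicity P (1 / 2 - 1 / (2 * real l)) = 1 \<and>
         (\<forall>x. eigenvalue P x \<longrightarrow>
            x \<in> {1, 1 - 1 / (2 * real l), 1 - 1 / real l, 1 / 2, 1 / 2 - 1 / (2 * real l)})"
proof -
  note \<chi> = char_poly_star_exclusion[OF assms(1-3), folded P_def]
  \<comment> \<open>Orders add over the factors of a nonzero product. The formula holds for every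
    \<open>x\<close>, before the five values are known to be distinct.\<close>
  have "alg_multiplicity P x = (if x = 1 - 1 / real l then (l choose 2) - l else 0)
      + (if x = 1 - 1 / (2 * real l) then l - 1 else 0) + (if x = 1 / 2 then l - 1 else 0)
      + (if x = 1 then 1 else 0) + (if x = 1 / 2 - 1 / (2 * real l) then 1 else 0)" for x
    unfolding alg_multiplicity_def \<chi>
    by (subst order_mult, simp only: mult_eq_0_iff power_eq_0_iff, simp)+
       (simp only: order_linear_power)
  moreover have "P \<in> carrier_mat (length ss) (length ss)"
    by (simp add: P_def transition_matrix_def)
  \<comment> \<open>For l = 3 the factor for 1 - 1/l has exponent 0, so the five values only contain
    the spectrum.\<close>
  then have "eigenvalue P x \<longleftrightarrow> poly (char_poly P) x = 0" for x
    by (rule eigenvalue_root_char_poly)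
  then have "\<forall>x. eigenvalue P x \<longrightarrow>
      x \<in> {1, 1 - 1 / (2 * real l), 1 - 1 / real l, 1 / 2, 1 / 2 - 1 / (2 * real l)}"
    unfolding \<chi> poly_mult poly_power poly_linear by auto
  moreover define a b c where "a = 1 - 1 / real l" and "b = 1 - 1 / (2 * real l)"
    and "c = 1 / 2 - 1 / (2 * real l)"
  \<comment> \<open>This chain separates the five values, so one summand survives in each
    multiplicity. The inequality \<open>1 / 2 < a\<close> means l > 2.\<close>
  have "c < 1 / 2" "1 / 2 < a" "a < b" "b < 1"
    using assms(1) by (simp_all add: a_def b_def c_def field_simps)
  ultimately show ?thesis
    unfolding a_def[symmetric] b_def[symmetric] c_def[symmetric] by auto
qed

end
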